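(* Let $c_1,c_2\ge0$, $b_1,b_2>0$, let $D=[c_1,c_1+b_1]\times[c_2,c_2+b_2]$, and let the buyer's valuation $z$ be uniformly distributed on $D$. Suppose $c_1\le b_1$ and $c_2\ge 2b_2\big(b_1/(b_1-c_1)\big)^2$ (the right-hand side being $+\infty$ when $c_1=b_1$, so that necessarily $c_1<b_1$). Then the optimal mechanism is the following: a buyer with $z_1<(c_1+b_1)/2$ receives the allocation $(0,1)$ and pays $c_2$, and a buyer with $z_1\ge(c_1+b_1)/2$ receives the allocation $(1,1)$ and pays $c_2+(c_1+b_1)/2$.
   Context: A seller sells two items to one buyer with valuation $z=(z_1,z_2)\in D$. A (direct) mechanism is a pair of an allocation function $q:D\to[0,1]^2$ and a payment function $t:D\to\mathbb{R}_{\ge0}$. It is incentive compatible if $z\cdot q(z)-t(z)\ge z\cdot q(\hat z)-t(\hat z)$ for all $z,\hat z\in D$, and individually rational if $z\cdot q(z)-t(z)\ge0$ for all $z\in D$. A mechanism is optimal if it maximizes the expected revenue $\mathbb{E}[t(z)]$ among all incentive compatible and individually rational mechanisms. "The optimal mechanism is X" means that mechanism X is optimal. *)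

theory Defs
  imports "HOL-Analysis.Analysis"
begin

definition mechanism ::
  "(real \<times> real) set \<Rightarrow> (real \<times> real \<Rightarrow> real \<times> real) \<Rightarrow> (real \<times> real \<Rightarrow> real) \<Rightarrow> bool" where
  "mechanism D q t \<longleftrightarrow> (\<forall>z\<in>D. q z \<in> {0..1} \<times> {0..1}) \<and> (\<forall>z\<in>D. 0 \<le> t z)"

definition incentive_compatible ::
  "(real \<times> real) set \<Rightarrow> (real \<times> real \<Rightarrow> real \<times> real) \<Rightarrow> (real \<times> real \<Rightarrow> real) \<Rightarrow> bool" where
  "incentive_compatible D q t \<longleftrightarrow> (\<forall>z\<in>D. \<forall>z'\<in>D. z \<bullet> q z - t z \<ge> z \<bullet> q z' - t z')"

definition individually_rational ::
  "(real \<times> real) set \<Rightarrow> (real \<times> real \<Rightarrow> real \<times> real) \<Rightarrow> (real \<times> real \<Rightarrow> real) \<Rightarrow> bool" where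
  "individually_rational D q t \<longleftrightarrow> (\<forall>z\<in>D. z \<bullet> q z - t z \<ge> 0)"

text \<open>
  The law of a valuation is a measure \<open>M\<close> whose space is the type space \<open>D\<close>.
\<close>

definition expected_revenue :: "(real \<times> real) measure \<Rightarrow> (real \<times> real \<Rightarrow> real) \<Rightarrow> real" where
  "expected_revenue M t = (\<integral>z. t z \<partial>M)"

definition optimal_mechanism ::
  "(real \<times> real) measure \<Rightarrow> (real \<times> real \<Rightarrow> real \<times> real) \<Rightarrow> (real \<times> real \<Rightarrow> real) \<Rightarrow> bool" where
  "optimal_mechanism M q t \<longleftrightarrow>
     mechanism (space M) q t \<and>
     incentive_compatible (space M) q t \<and>
     individually_rational (space M) q t \<and>
     (\<forall>q' t'. mechanism (space M) q' t' \<longrightarrow>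
        incentive_compatible (space M) q' t' \<longrightarrow>
        individually_rational (space M) q' t' \<longrightarrow>
        expected_revenue M t' \<le> expected_revenue M t)"

text \<open>
  The uniform law is taken on the Lebesgue (completed) sigma-algebra of \<open>D\<close>. The payment of an
  incentive compatible mechanism on a box is determined by the gradient of the convex function
  \<open>z \<mapsto> z \<bullet> q z - t z\<close> outside a null set, on which it may fail to be Borel; it is always
  Lebesgue measurable. With individual rationality it is also bounded, so no measurability or
  integrability condition on mechanisms is needed for the expected revenue to be a genuine
  expectation.
\<close>

definition uniform_on :: "(real \<times> real) set \<Rightarrow> (real \<times> real) measure" where
  "uniform_on D = uniform_measure (lebesgue_on D) D"

lemma space_uniform_on [simp]: "space (uniform_on D) = D"
  by (simp add: uniform_on_def)

end

theory Submission imports Defs begin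

text \<open>
  An incentive compatible mechanism has a convex utility \<open>U\<close> with partial slopes in \<open>[0, 1]\<close>,
  and its payment is at most \<open>z \<bullet> \<nabla>U z - U z\<close>. Integrate by parts along each coordinate.
  For item 1, \<open>U (d, y) \<le> U (x, y) + d - x\<close> with \<open>d = c1 + b1\<close> and \<open>x\<close> above the monopoly
  price \<open>d / 2\<close> yields the revenue of that price minus terms in \<open>\<Phi> x = \<integral>U (x, y) dy\<close> for low \<open>x\<close>. For item 2, the revenue falls short of
  full sale by at least \<open>c2\<close> times \<open>\<integral>(b2 - V x) dx\<close>, where \<open>V x\<close> is the increase of \<open>U\<close> along
  the vertical segment at \<open>x\<close>. Unit slopes give \<open>b2 (b2 - V x) \<ge> b2\<^sup>2 / 2 - \<Phi> x\<close>. Using this on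
  an initial interval only, convexity of \<open>\<Phi>\<close> closes the estimate precisely when
  \<open>c2 \<ge> 2 b2 (b1 / (b1 - c1))\<^sup>2\<close>.

  Derivatives are avoided: \<open>U\<close> extends to the plane as a supremum of affine functions, the gradient
  is replaced by difference quotients with step \<open>k > 0\<close>, which bound the payment pointwise, and
  \<open>k\<close> tends to \<open>0\<close> at the end.
\<close>

section \<open>One-dimensional revenue estimates for utilities with slopes in [0, 1]\<close>

definition unit_slope :: "(real \<Rightarrow> real) \<Rightarrow> bool" where
  "unit_slope h \<longleftrightarrow> (\<forall>x y. x \<le> y \<longrightarrow> h x \<le> h y \<and> h y \<le> h x + (y - x))"

lemma unit_slopeD:
  assumes "unit_slope h" "x \<le> y"
  shows "h x \<le> h y" "h y \<le> h x + (y - x)"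
  using assms by (auto simp: unit_slope_def)

lemma unit_slope_continuous:
  assumes "unit_slope h"
  shows "continuous_on A h"
proof -
  have "dist (h x) (h y) \<le> 1 * dist x y" for x y
    using unit_slopeD[OF assms, of x y] unit_slopeD[OF assms, of y x]
    by (cases "x \<le> y") (auto simp: dist_real_def)
  then have "1-lipschitz_on A h"
    by (intro lipschitz_onI) auto
  then show ?thesis
    by (rule lipschitz_on_continuous_on)
qed

text \<open>The common part of the two intervals cancels, leaving end strips of width
  \<open>k\<close>. Divided by \<open>k\<close>, this is the discrete fundamental theorem of
  calculus that stands in for integration by parts.\<close>

lemma integral_shift_difference:
  fixes g :: "real \<Rightarrow> real"
  assumes "continuous_on UNIV g" "a \<le> b" "0 \<le> k"
  shows "integral {a..b} (\<lambda>x. g (x + k)) - integral {a..b} g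
       = integral {b..b + k} g - integral {a..a + k} g"
proof -
  have int: "g integrable_on {u..v}" for u v
    using assms(1) by (intro integrable_continuous_interval) (rule continuous_on_subset, auto)
  have "integral {a..b} (\<lambda>x. g (x + k)) = integral {a + k..b + k} g"
    using integral_shift_Icc_real[of a b g k] by (simp add: o_def add.commute)
  moreover have "integral {a..a + k} g + integral {a + k..b + k} g = integral {a..b + k} g"
    using assms by (intro Henstock_Kurzweil_Integration.integral_combine int) auto
  moreover have "integral {a..b} g + integral {b..b + k} g = integral {a..b + k} g"
    using assms by (intro Henstock_Kurzweil_Integration.integral_combine int) auto
  ultimately show ?thesis
    by linarith
qed

text \<open>Split \<open>x = a + (x - a)\<close>. The slope weighted with the constant
  \<open>a\<close> telescopes to \<open>a\<close> times the increase of \<open>h\<close>, and in the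
  rest the slope is at most 1. Nothing but the error term is lost when \<open>h\<close> has slope 1
  throughout, as the optimal utility does in item 2.\<close>

lemma item_with_base_price_bound:
  assumes h: "unit_slope h" and "0 \<le> a" "a \<le> b" "0 < k"
  shows "integral {a..b} (\<lambda>x. x * ((h (x + k) - h x) / k)) \<le> a * (h b - h a + k) + (b - a)\<^sup>2 / 2"
proof -
  note cont = continuous_on_compose2[OF unit_slope_continuous[OF h, of UNIV]]
  have diff: "(h (x + k) - h x) / k \<le> 1" for x
    using unit_slopeD[OF h, of x "x + k"] \<open>0 < k\<close> by (simp add: field_simps)
  have "integral {a..b} (\<lambda>x. x * ((h (x + k) - h x) / k))
      \<le> integral {a..b} (\<lambda>x. (a / k) * (h (x + k) - h x) + (x - a))"
  proof (rule integral_le)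
    fix x assume x: "x \<in> {a..b}"
    have "(x - a) * ((h (x + k) - h x) / k) \<le> (x - a) * 1"
      using x by (intro mult_left_mono diff) auto
    moreover have "(a / k) * (h (x + k) - h x) = a * ((h (x + k) - h x) / k)"
      by simp
    ultimately show "x * ((h (x + k) - h x) / k) \<le> (a / k) * (h (x + k) - h x) + (x - a)"
      unfolding left_diff_distrib by linarith
  qed (use \<open>0 < k\<close> in \<open>auto intro!: integrable_continuous_interval continuous_intros cont\<close>)
  also have "\<dots> = (a / k) * (integral {a..b} (\<lambda>x. h (x + k)) - integral {a..b} h) + (b - a)\<^sup>2 / 2"
  proof -
    have "((\<lambda>x. (a / k) * (h (x + k) - h x) + (x - a)) has_integral
        (a / k) * (integral {a..b} (\<lambda>x. h (x + k)) - integral {a..b} h)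
         + ((b\<^sup>2 - a\<^sup>2) / 2 - (b - a) * a)) {a..b}"
      using \<open>a \<le> b\<close> has_integral_const_real[of a a b]
      by (intro has_integral_add has_integral_diff has_integral_mult_right ident_has_integral
           integrable_integral integrable_continuous_interval continuous_intros cont) auto
    then show ?thesis
      by (simp add: integral_unique power2_eq_square field_simps)
  qed
  also have "\<dots> \<le> (a / k) * (k * (h b + k) - k * h a) + (b - a)\<^sup>2 / 2"
  proof (intro add_right_mono mult_left_mono)
    have "integral {b..b + k} h \<le> integral {b..b + k} (\<lambda>_. h b + k)"
      using unit_slopeD(2)[OF h, of b] \<open>0 < k\<close>
      by (intro integral_le integrable_continuous_interval continuous_intros cont) (auto, smt (verit))
    moreover have "integral {a..a + k} (\<lambda>_. h a) \<le> integral {a..a + k} h"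
      using unit_slopeD(1)[OF h, of a]
      by (intro integral_le integrable_continuous_interval continuous_intros cont) auto
    ultimately show "integral {a..b} (\<lambda>x. h (x + k)) - integral {a..b} h \<le> k * (h b + k) - k * h a"
      using integral_shift_difference[of h a b k] assms unit_slope_continuous[OF h] by simp
  qed (use assms in auto)
  also have "(a / k) * (k * (h b + k) - k * h a) = a * (h b - h a + k)"
    using \<open>0 < k\<close> by (simp add: field_simps)
  finally show ?thesis .
qed

text \<open>
  The right-hand side is, up to the error term, the revenue of posting the monopoly price
  \<open>b / 2\<close> for one item of value uniform on \<open>[a, b]\<close>, corrected for the
  utility left to the types below that price.
\<close>

lemma item_with_monopoly_price_bound:
  assumes h: "unit_slope h" and "0 \<le> a" "a \<le> b / 2" "0 < k" "0 \<le> h a"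
  shows "integral {a..b} (\<lambda>x. x * ((h (x + k) - h x) / k) - h x)
       \<le> (b / 2)\<^sup>2 - a * h a - 2 * integral {a..b / 2} h + k * (h b + b + k)"
proof -
  note cont = continuous_on_compose2[OF unit_slope_continuous[OF h, of UNIV]]
  note icont = integrable_continuous_interval continuous_intros cont
  have "a \<le> b" "0 \<le> b" using assms by auto
  have "0 \<le> h b"
    using unit_slopeD(1)[OF h \<open>a \<le> b\<close>] assms by simp
  \<comment> \<open>In the limit the identity is \<open>x * h' - h = (x * h)' - 2 * h\<close>, so
    \<open>g\<close> supplies the boundary terms.\<close>
  define g where "g = (\<lambda>x. x * h x)"
  have g: "continuous_on UNIV g"
    unfolding g_def by (intro continuous_intros cont) auto
  note gcont = continuous_on_compose2[OF g]
  have 1: "integral {b..b + k} g \<le> k * ((b + k) * (h b + k))"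
  proof -
    have "integral {b..b + k} g \<le> integral {b..b + k} (\<lambda>_. (b + k) * (h b + k))"
    proof (intro integral_le)
      fix x assume "x \<in> {b..b + k}"
      then show "g x \<le> (b + k) * (h b + k)"
        unfolding g_def using unit_slopeD[OF h, of b x] \<open>0 \<le> h b\<close> \<open>0 \<le> b\<close>
        by (intro mult_mono) auto
    qed (auto intro!: icont gcont)
    then show ?thesis using \<open>0 < k\<close> by (simp add: mult_ac)
  qed
  have 2: "k * (a * h a) \<le> integral {a..a + k} g"
  proof -
    have "integral {a..a + k} (\<lambda>_. a * h a) \<le> integral {a..a + k} g"
    proof (intro integral_le)
      fix x assume "x \<in> {a..a + k}"
      then show "a * h a \<le> g x"
        unfolding g_def using unit_slopeD[OF h, of a x] assms by (intro mult_mono) auto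
    qed (auto intro!: icont gcont)
    then show ?thesis using \<open>0 < k\<close> by (simp add: mult_ac)
  qed
  have "integral {a..b} (\<lambda>x. x * ((h (x + k) - h x) / k) - h x)
      \<le> integral {a..b} (\<lambda>x. (1 / k) * (g (x + k) - g x) - 2 * h x)"
  proof (intro integral_le)
    fix x assume x: "x \<in> {a..b}"
    \<comment> \<open>The discrete product rule produces \<open>h (x + k)\<close> where the
      derivative would give \<open>h x\<close>; monotonicity of \<open>h\<close> allows the exchange
      in the required direction.\<close>
    have "(1 / k) * (g (x + k) - g x) = x * ((h (x + k) - h x) / k) + h (x + k)"
      using \<open>0 < k\<close> by (simp add: g_def field_simps)
    then show "x * ((h (x + k) - h x) / k) - h x \<le> (1 / k) * (g (x + k) - g x) - 2 * h x"
      using unit_slopeD(1)[OF h, of x "x + k"] \<open>0 < k\<close> by simp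
  qed (use \<open>0 < k\<close> in \<open>auto intro!: icont gcont\<close>)
  also have "\<dots> = (1 / k) * (integral {a..b} (\<lambda>x. g (x + k)) - integral {a..b} g)
       - 2 * integral {a..b} h"
    by (intro integral_unique has_integral_diff has_integral_mult_right integrable_integral icont gcont) auto
  also have "\<dots> \<le> (1 / k) * (k * ((b + k) * (h b + k)) - k * (a * h a)) - 2 * integral {a..b} h"
    using integral_shift_difference[OF g \<open>a \<le> b\<close>, of k] 1 2 \<open>0 < k\<close>
    by (intro diff_right_mono mult_left_mono) auto
  also have "\<dots> = (b + k) * (h b + k) - a * h a - 2 * integral {a..b} h"
    using \<open>0 < k\<close> by (simp add: field_simps)
  also have "integral {a..b} h = integral {a..b / 2} h + integral {b / 2..b} h"
    using \<open>0 \<le> b\<close> assms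
    by (intro Henstock_Kurzweil_Integration.integral_combine[symmetric] icont) auto
  finally have *: "integral {a..b} (\<lambda>x. x * ((h (x + k) - h x) / k) - h x)
      \<le> (b + k) * (h b + k) - a * h a - 2 * (integral {a..b / 2} h + integral {b / 2..b} h)" .
  \<comment> \<open>The interval has length \<open>b / 2\<close>, so twice this lower bound contains
    exactly \<open>b * h b\<close>. It cancels the boundary term at \<open>b\<close>, and what
    remains is the monopoly revenue \<open>(b / 2)^2\<close>.\<close>
  have "b / 2 * (h b - b) + (b\<^sup>2 - (b / 2)\<^sup>2) / 2 = integral {b / 2..b} (\<lambda>x. (h b - b) + x)"
  proof -
    have "((\<lambda>x. (h b - b) + x) has_integral b / 2 * (h b - b) + (b\<^sup>2 - (b / 2)\<^sup>2) / 2) {b / 2..b}"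
      using \<open>0 \<le> b\<close> has_integral_const_real[of "h b - b" "b / 2" b]
      by (intro has_integral_add ident_has_integral) auto
    then show ?thesis by (simp add: integral_unique)
  qed
  also have "\<dots> \<le> integral {b / 2..b} h"
    using unit_slopeD(2)[OF h, of _ b] 
    by (intro integral_le icont) (auto simp: algebra_simps)
  finally show ?thesis
    using * by (simp add: power2_eq_square field_simps)
qed

text \<open>
  \<open>V s\<close> stands for the utility gained along the edge \<open>{s} \<times> [c2, c2 + b2]\<close> and
  \<open>\<Phi> s\<close> for the total utility on it. The factor \<open>l\<close> below is chosen such that shrinking
  \<open>[c1, (c1 + b1) / 2]\<close> by \<open>l\<close> towards \<open>c1\<close> balances the gain in
  \<open>\<integral>\<Phi>\<close> from convexity exactly against the hypothesis on \<open>c2\<close>.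
\<close>

lemma deficit_bound:
  fixes \<Phi> V :: "real \<Rightarrow> real"
  assumes "0 \<le> c1" "c1 < b1" "0 < b2"
    and c2: "c2 \<ge> 2 * b2 * (b1 / (b1 - c1))\<^sup>2"
    and \<Phi>: "continuous_on UNIV \<Phi>" and V: "continuous_on UNIV V"
    and V_le: "\<And>s. V s \<le> b2"
    and V_\<Phi>: "\<And>s. c1 \<le> s \<Longrightarrow> b2\<^sup>2 / 2 - \<Phi> s \<le> b2 * (b2 - V s)"
    and convex: "\<And>l s. 0 \<le> l \<Longrightarrow> l \<le> 1 \<Longrightarrow> \<Phi> (l * s + (1 - l) * c1) \<le> l * \<Phi> s + (1 - l) * \<Phi> c1"
  shows "b1 * b2\<^sup>2 / 2 \<le> c2 * integral {c1..c1 + b1} (\<lambda>s. b2 - V s)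
     + c1 * \<Phi> c1 + 2 * integral {c1..(c1 + b1) / 2} \<Phi>"
proof -
  define l where "l = (b1 - c1) / b1"
  define p where "p = (c1 + b1) / 2"
  define r where "r = l * p + (1 - l) * c1"
  \<comment> \<open>The hypothesis on \<open>c2\<close> reads \<open>\<kappa> * b2 \<le> c2\<close>.
    Moreover \<open>\<kappa> * l^2 = 2\<close> is the factor in front of the integral of
    \<open>\<Phi>\<close>, and \<open>\<kappa> * (r - c1) = b1\<close> makes the constants
    \<open>b2^2 / 2\<close> collected over \<open>[c1, r]\<close> add up to the left-hand
    side.\<close>
  define \<kappa> where "\<kappa> = 2 / l\<^sup>2"
  have l: "0 < l" "l \<le> 1"
    using assms by (auto simp: l_def)
  have p: "c1 \<le> p"
    using assms by (simp add: p_def)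
  have r: "r - c1 = l * (p - c1)"
    by (simp add: r_def algebra_simps)
  have \<kappa>: "0 < \<kappa>" "\<kappa> * l\<^sup>2 = 2"
    using l by (auto simp: \<kappa>_def)
  have lb1: "l * b1 = 2 * (p - c1)"
    using assms by (simp add: l_def p_def field_simps)
  have "\<kappa> * (r - c1) = \<kappa> * l * (2 * (p - c1)) / 2"
    unfolding r by simp
  also have "\<dots> = (\<kappa> * l\<^sup>2) * b1 / 2"
    unfolding lb1[symmetric] by (simp add: power2_eq_square)
  finally have kr: "\<kappa> * (r - c1) = b1"
    unfolding \<kappa> by simp
  have "c1 \<le> r"
    using r l p by (smt (verit) mult_nonneg_nonneg)
  have "r \<le> p"
    using r l p by (smt (verit) mult_left_le_one_le)
  then have "r \<le> c1 + b1"
    using assms by (simp add: p_def)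
  have "\<kappa> * b2 \<le> c2"
    using c2 by (simp add: \<kappa>_def l_def power_divide field_simps)
  note icont = integrable_continuous_interval continuous_intros continuous_on_subset[OF \<Phi>]
    continuous_on_subset[OF V] continuous_on_compose2[OF \<Phi>]

  have "\<kappa> * (b2\<^sup>2 / 2 * (r - c1) - integral {c1..r} \<Phi>) = \<kappa> * integral {c1..r} (\<lambda>s. b2\<^sup>2 / 2 - \<Phi> s)"
    using \<open>c1 \<le> r\<close> by (subst Henstock_Kurzweil_Integration.integral_diff) (auto intro!: icont)
  also have "\<dots> \<le> \<kappa> * integral {c1..r} (\<lambda>s. b2 * (b2 - V s))"
    using \<kappa> V_\<Phi> by (intro mult_left_mono integral_le icont) auto
  also have "\<dots> = \<kappa> * b2 * integral {c1..r} (\<lambda>s. b2 - V s)"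
    by simp
  also have "\<dots> \<le> c2 * integral {c1..r} (\<lambda>s. b2 - V s)"
    using V_le by (intro mult_right_mono \<open>\<kappa> * b2 \<le> c2\<close> integral_nonneg icont) auto
  also have "\<dots> \<le> c2 * integral {c1..c1 + b1} (\<lambda>s. b2 - V s)"
  proof (intro mult_left_mono integral_subset_le icont)
    show "0 \<le> c2"
      using \<open>\<kappa> * b2 \<le> c2\<close> \<kappa> \<open>0 < b2\<close> by (smt (verit) mult_nonneg_nonneg)
  qed (use V_le \<open>r \<le> c1 + b1\<close> in auto)
  finally have 1: "b1 * b2\<^sup>2 / 2 - \<kappa> * integral {c1..r} \<Phi> \<le> c2 * integral {c1..c1 + b1} (\<lambda>s. b2 - V s)"
    unfolding kr[symmetric] by (simp add: algebra_simps)

  \<comment> \<open>The contraction towards \<open>c1\<close> maps \<open>[c1, p]\<close> onto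
    \<open>[c1, r]\<close>. The change of variables gives one factor \<open>l\<close> and convexity
    a second one, hence the \<open>l^2\<close> in \<open>\<kappa>\<close>.\<close>
  have "((\<lambda>s. \<Phi> (l * s + (1 - l) * c1)) has_integral integral {c1..r} \<Phi> / l) {c1..p}"
  proof -
    have "(\<Phi> has_integral integral {c1..r} \<Phi>) (cbox c1 r)"
      by (auto intro!: integrable_integral icont)
    from has_integral_affinity'[OF this l(1), of "(1 - l) * c1"]
    show ?thesis
      using l by (simp add: r_def field_simps)
  qed
  then have "integral {c1..r} \<Phi> = l * integral {c1..p} (\<lambda>s. \<Phi> (l * s + (1 - l) * c1))"
    using l by (simp add: integral_unique)
  also have "\<dots> \<le> l * integral {c1..p} (\<lambda>s. l * \<Phi> s + (1 - l) * \<Phi> c1)"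
    using l convex by (intro mult_left_mono integral_le icont) auto
  also have "\<dots> = l * (l * integral {c1..p} \<Phi> + (1 - l) * \<Phi> c1 * (p - c1))"
    using p by (subst Henstock_Kurzweil_Integration.integral_add) (auto intro!: icont)
  finally have "\<kappa> * integral {c1..r} \<Phi> \<le> \<kappa> * (l * (l * integral {c1..p} \<Phi> + (1 - l) * \<Phi> c1 * (p - c1)))"
    using \<kappa> by (intro mult_left_mono) auto
  also have "\<dots> = (\<kappa> * l\<^sup>2) * integral {c1..p} \<Phi> + (1 - l) * (\<kappa> * (r - c1)) * \<Phi> c1"
    unfolding r by (simp add: power2_eq_square algebra_simps)
  \<comment> \<open>Here \<open>(1 - l) * b1 = c1\<close>, which is where the term
    \<open>c1 * \<Phi> c1\<close> comes from.\<close>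
  also have "\<dots> = 2 * integral {c1..p} \<Phi> + c1 * \<Phi> c1"
    unfolding \<kappa> kr using assms by (simp add: l_def field_simps)
  finally show ?thesis
    using 1 unfolding p_def by linarith
qed

section \<open>Integration against a uniform measure\<close>

lemma integral_uniform_measure:
  fixes f :: "'a \<Rightarrow> real"
  assumes [measurable]: "A \<in> sets M" "f \<in> borel_measurable M" and "emeasure M A \<noteq> 0" "emeasure M A \<noteq> \<infinity>"
  shows "integral\<^sup>L (uniform_measure M A) f = (\<integral>x. indicator A x * f x \<partial>M) / measure M A"
    and "integrable (uniform_measure M A) f \<longleftrightarrow> integrable M (\<lambda>x. indicator A x * f x)"
proof -
  have pos: "0 < measure M A"
    using assms by (metis emeasure_eq_ennreal_measure ennreal_0 infinity_ennreal_def less_eq_real_def measure_nonneg)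
  \<comment> \<open>The measure of \<open>A\<close> is finite and nonzero, so the extended density
    is a real one and the rules for Bochner integrals with real densities apply.\<close>
  have eq: "uniform_measure M A = density M (\<lambda>x. ennreal (indicator A x / measure M A))"
    unfolding uniform_measure_def
    using assms pos
    by (intro density_cong)
       (auto simp: emeasure_eq_ennreal_measure divide_ennreal[of 1 "measure M A", simplified]
         split: split_indicator)
  show "integral\<^sup>L (uniform_measure M A) f = (\<integral>x. indicator A x * f x \<partial>M) / measure M A"
    unfolding eq by (subst integral_real_density) auto
  show "integrable (uniform_measure M A) f \<longleftrightarrow> integrable M (\<lambda>x. indicator A x * f x)"
    unfolding eq using pos integrable_mult_left_iff[where M = M and c = "1 / measure M A" and f = "\<lambda>x. indicator A x * f x"]
    by (subst integrable_real_density) auto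
qed

section \<open>The revenue bound on the box\<close>

lemma nonexpansive_sections_continuous:
  fixes U :: "real \<times> real \<Rightarrow> real"
  assumes "\<And>y. unit_slope (\<lambda>x. U (x, y))" "\<And>x. unit_slope (\<lambda>y. U (x, y))"
  shows "continuous_on A U"
proof -
  \<comment> \<open>Moving one coordinate at a time gives two legs, each no longer than the
    distance; hence the constant 2.\<close>
  have "dist (U z) (U w) \<le> 2 * dist z w" for z w
  proof -
    obtain x y x' y' where z: "z = (x, y)" and w: "w = (x', y')"
      by (cases z, cases w) auto
    have "\<bar>U (x, y) - U (x', y)\<bar> \<le> \<bar>x - x'\<bar>"
      using unit_slopeD[OF assms(1)[of y], of x x'] unit_slopeD[OF assms(1)[of y], of x' x] by linarith
    moreover have "\<bar>U (x', y) - U (x', y')\<bar> \<le> \<bar>y - y'\<bar>"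
      using unit_slopeD[OF assms(2)[of x'], of y y'] unit_slopeD[OF assms(2)[of x'], of y' y] by linarith
    moreover have "\<bar>x - x'\<bar> \<le> dist z w" "\<bar>y - y'\<bar> \<le> dist z w"
      using dist_fst_le[of z w] dist_snd_le[of z w] by (auto simp: z w dist_real_def)
    ultimately show ?thesis
      by (simp add: z w dist_real_def)
  qed
  then have "2-lipschitz_on A U"
    by (intro lipschitz_onI) auto
  then show ?thesis
    by (rule lipschitz_on_continuous_on)
qed

text \<open>This is \<open>z \<bullet> \<nabla>U z - U z\<close> with forward difference quotients
  as partial derivatives. The term \<open>- U\<close> is grouped with item 1, whose monopoly bound
  absorbs it.\<close>

definition difference_revenue :: "(real \<times> real \<Rightarrow> real) \<Rightarrow> real \<Rightarrow> real \<times> real \<Rightarrow> real" where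
  "difference_revenue U k = (\<lambda>(x, y). (x * ((U (x + k, y) - U (x, y)) / k) - U (x, y))
     + y * ((U (x, y + k) - U (x, y)) / k))"

text \<open>For \<open>k = 0\<close> the right-hand side is the area of the box times the revenue of
  the claimed optimum. By Fubini, item 1 is estimated on horizontal lines and item 2 on vertical
  ones; \<open>deficit_bound\<close> absorbs the utility terms that are left.\<close>

lemma integral_difference_revenue_le:
  fixes U :: "real \<times> real \<Rightarrow> real"
  assumes pos: "0 \<le> c1" "0 \<le> c2" "0 < b2" "c1 < b1"
    and c2: "c2 \<ge> 2 * b2 * (b1 / (b1 - c1))\<^sup>2"
    and slope1: "\<And>y. unit_slope (\<lambda>x. U (x, y))" and slope2: "\<And>x. unit_slope (\<lambda>y. U (x, y))"
    and convex: "\<And>l x x' y. 0 \<le> l \<Longrightarrow> l \<le> 1 \<Longrightarrow>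
          U (l * x + (1 - l) * x', y) \<le> l * U (x, y) + (1 - l) * U (x', y)"
    and nonneg: "0 \<le> U (c1, c2)"
    and k: "0 < k" "k \<le> 1"
  shows "integral (cbox (c1, c2) (c1 + b1, c2 + b2)) (difference_revenue U k)
      \<le> b1 * b2 * c2 + b2 * ((c1 + b1) / 2)\<^sup>2
        + k * (b2 * (U (c1 + b1, c2 + b2) + (c1 + b1) + 1) + b1 * c2)"
proof -
  define d1 d2 where "d1 = c1 + b1" and "d2 = c2 + b2"
  have le: "c1 \<le> d1" "c2 \<le> d2" "c1 \<le> d1 / 2" "d1 - c1 = b1" "d2 - c2 = b2"
    using pos by (auto simp: d1_def d2_def)
  note cont = continuous_on_compose2[OF nonexpansive_sections_continuous[OF slope1 slope2, of UNIV]]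
  define A B where "A = (\<lambda>x y. x * ((U (x + k, y) - U (x, y)) / k) - U (x, y))"
    and "B = (\<lambda>x y. y * ((U (x, y + k) - U (x, y)) / k))"
  have A: "continuous_on S (\<lambda>z. A (fst z) (snd z))" and B: "continuous_on S (\<lambda>z. B (fst z) (snd z))" for S
    unfolding A_def B_def using k by (auto intro!: continuous_intros cont)
  have A_swap: "continuous_on S (\<lambda>z. A (snd z) (fst z))" for S
    unfolding A_def using k by (auto intro!: continuous_intros cont)
  define \<Phi> where "\<Phi> = (\<lambda>x. integral {c2..d2} (\<lambda>y. U (x, y)))"
  define V where "V = (\<lambda>x. U (x, d2) - U (x, c2))"
  have contU: "continuous_on S (\<lambda>(x, y). U (x, y))" "continuous_on S (\<lambda>(y, x). U (x, y))" for S
    by (auto simp: case_prod_unfold intro!: continuous_intros cont)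
  have cont\<Phi>: "continuous_on S \<Phi>" for S
    using integral_continuous_on_param[of S c2 d2 "\<lambda>x y. U (x, y)", OF contU(1)] by (simp add: \<Phi>_def)
  have contV: "continuous_on S V" for S
    unfolding V_def by (auto intro!: continuous_intros cont)
  note icont = integrable_continuous_interval continuous_intros cont cont\<Phi> contV

  have U_nonneg: "0 \<le> U (x, y)" if "c1 \<le> x" "c2 \<le> y" for x y
    using nonneg unit_slopeD(1)[OF slope1, of c1 x c2] unit_slopeD(1)[OF slope2, of c2 y x] that by simp

  have "b1 * b2\<^sup>2 / 2 \<le> c2 * integral {c1..c1 + b1} (\<lambda>s. b2 - V s)
     + c1 * \<Phi> c1 + 2 * integral {c1..(c1 + b1) / 2} \<Phi>"
  proof (rule deficit_bound)
    fix s
    show "V s \<le> b2"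
      using unit_slopeD(2)[OF slope2, of c2 d2 s] le by (simp add: V_def)
    assume "c1 \<le> s"
    \<comment> \<open>Going down from the top of the edge, \<open>U (s, y)\<close> is at least
      \<open>U (s, d2) - (d2 - y)\<close>, and \<open>U (s, d2)\<close> is at least
      \<open>V s\<close> because \<open>U (s, c2)\<close> is nonnegative.\<close>
    have "integral {c2..d2} (\<lambda>y. (V s - d2) + y) \<le> \<Phi> s"
      unfolding \<Phi>_def
    proof (intro integral_le icont)
      fix y assume "y \<in> {c2..d2}"
      then show "V s - d2 + y \<le> U (s, y)"
        using unit_slopeD(2)[OF slope2, of y d2 s] U_nonneg[OF \<open>c1 \<le> s\<close>, of c2] by (simp add: V_def)
    qed auto
    moreover have "((\<lambda>y. (V s - d2) + y) has_integral b2 * (V s - d2) + (d2\<^sup>2 - c2\<^sup>2) / 2) {c2..d2}"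
      using le has_integral_const_real[of "V s - d2" c2 d2]
      by (intro has_integral_add ident_has_integral) auto
    ultimately show "b2\<^sup>2 / 2 - \<Phi> s \<le> b2 * (b2 - V s)"
      by (simp add: integral_unique d2_def power2_eq_square algebra_simps add_divide_distrib)
  next
    fix l s :: real
    assume l: "0 \<le> l" "l \<le> 1"
    have "\<Phi> (l * s + (1 - l) * c1) \<le> integral {c2..d2} (\<lambda>y. l * U (s, y) + (1 - l) * U (c1, y))"
      unfolding \<Phi>_def by (intro integral_le icont convex l) auto
    also have "\<dots> = l * \<Phi> s + (1 - l) * \<Phi> c1"
      unfolding \<Phi>_def
      by (intro integral_unique has_integral_add has_integral_mult_right integrable_integral icont) auto
    finally show "\<Phi> (l * s + (1 - l) * c1) \<le> l * \<Phi> s + (1 - l) * \<Phi> c1" .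
  qed (use pos c2 cont\<Phi> contV in auto)
  also have "integral {c1..c1 + b1} (\<lambda>s. b2 - V s) = b1 * b2 - integral {c1..d1} V"
    unfolding d1_def
    using pos by (subst Henstock_Kurzweil_Integration.integral_diff) (auto intro!: icont)
  finally have deficit: "b1 * b2\<^sup>2 / 2 \<le> c2 * (b1 * b2 - integral {c1..d1} V)
     + c1 * \<Phi> c1 + 2 * integral {c1..d1 / 2} \<Phi>"
    unfolding d1_def .

  \<comment> \<open>The error of the monopoly bound grows with \<open>y\<close> and
    \<open>k\<close>, so its values at \<open>y = d2\<close> and \<open>k = 1\<close> serve for
    every horizontal line.\<close>
  define K where "K = U (d1, d2) + d1 + 1"
  have A_le: "integral {c1..d1} (\<lambda>x. A x y)
      \<le> (d1 / 2)\<^sup>2 + k * K - c1 * U (c1, y) - 2 * integral {c1..d1 / 2} (\<lambda>x. U (x, y))"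
    if y: "y \<in> {c2..d2}" for y
  proof -
    have "k * (U (d1, y) + d1 + k) \<le> k * K"
      unfolding K_def using k y unit_slopeD(1)[OF slope2, of y d2 d1] by (intro mult_left_mono) auto
    then show ?thesis
      using item_with_monopoly_price_bound[OF slope1 pos(1) le(3) k(1) U_nonneg, of y] y
      unfolding A_def by auto
  qed
  have swap: "integral {c2..d2} (\<lambda>y. integral {c1..d1 / 2} (\<lambda>x. U (x, y))) = integral {c1..d1 / 2} \<Phi>"
    unfolding \<Phi>_def
    using integral_swap_continuous[of c1 c2 "d1 / 2" d2 "\<lambda>x y. U (x, y)", OF contU(1)] by simp
  have "integral {c1..d1} (\<lambda>x. integral {c2..d2} (A x)) = integral {c2..d2} (\<lambda>y. integral {c1..d1} (\<lambda>x. A x y))"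
    using integral_swap_continuous[of c1 c2 d1 d2 A] A by (simp add: case_prod_unfold)
  also have "\<dots> \<le> integral {c2..d2} (\<lambda>y. (d1 / 2)\<^sup>2 + k * K - c1 * U (c1, y)
      - 2 * integral {c1..d1 / 2} (\<lambda>x. U (x, y)))"
  proof (intro integral_le A_le integrable_continuous_interval continuous_intros cont)
    show "continuous_on {c2..d2} (\<lambda>y. integral {c1..d1} (\<lambda>x. A x y))"
      using integral_continuous_on_param[of "{c2..d2}" c1 d1 "\<lambda>y x. A x y"] A_swap
      by (simp add: case_prod_unfold)
    show "continuous_on {c2..d2} (\<lambda>y. integral {c1..d1 / 2} (\<lambda>x. U (x, y)))"
      using integral_continuous_on_param[of "{c2..d2}" c1 "d1 / 2" "\<lambda>y x. U (x, y)", OF contU(2)] by simp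
  qed auto
  also have "\<dots> = b2 * ((d1 / 2)\<^sup>2 + k * K) - c1 * \<Phi> c1 - 2 * integral {c1..d1 / 2} \<Phi>"
  proof -
    have "continuous_on {c2..d2} (\<lambda>y. integral {c1..d1 / 2} (\<lambda>x. U (x, y)))"
      using integral_continuous_on_param[of "{c2..d2}" c1 "d1 / 2" "\<lambda>y x. U (x, y)", OF contU(2)] by simp
    then have "((\<lambda>y. integral {c1..d1 / 2} (\<lambda>x. U (x, y))) has_integral integral {c1..d1 / 2} \<Phi>) {c2..d2}"
      unfolding swap[symmetric] by (intro integrable_integral integrable_continuous_interval)
    moreover have "((\<lambda>y. U (c1, y)) has_integral \<Phi> c1) {c2..d2}"
      unfolding \<Phi>_def by (intro integrable_integral icont) auto
    ultimately show ?thesis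
      using has_integral_const_real[of "(d1 / 2)\<^sup>2 + k * K" c2 d2] le
      by (intro integral_unique has_integral_diff has_integral_mult_right) auto
  qed
  finally have A_total: "integral {c1..d1} (\<lambda>x. integral {c2..d2} (A x))
      \<le> b2 * ((d1 / 2)\<^sup>2 + k * K) - c1 * \<Phi> c1 - 2 * integral {c1..d1 / 2} \<Phi>" .

  have "integral {c1..d1} (\<lambda>x. integral {c2..d2} (B x)) \<le> integral {c1..d1} (\<lambda>x. c2 * V x + (c2 * k + b2\<^sup>2 / 2))"
  proof (intro integral_le icont)
    fix x
    show "integral {c2..d2} (B x) \<le> c2 * V x + (c2 * k + b2\<^sup>2 / 2)"
      using item_with_base_price_bound[OF slope2, of c2 d2 k x] k pos le
      by (simp add: B_def V_def algebra_simps)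
    show "continuous_on {c1..d1} (\<lambda>x. integral {c2..d2} (B x))"
      using integral_continuous_on_param[of "{c1..d1}" c2 d2 B] B by (simp add: case_prod_unfold)
  qed
  also have "\<dots> = c2 * integral {c1..d1} V + b1 * (c2 * k + b2\<^sup>2 / 2)"
    using has_integral_const_real[of "c2 * k + b2\<^sup>2 / 2" c1 d1] le
    by (intro integral_unique has_integral_add has_integral_mult_right integrable_integral icont) auto
  finally have B_total: "integral {c1..d1} (\<lambda>x. integral {c2..d2} (B x))
      \<le> c2 * integral {c1..d1} V + b1 * (c2 * k + b2\<^sup>2 / 2)" .

  have split: "difference_revenue U k = (\<lambda>z. A (fst z) (snd z) + B (fst z) (snd z))"
    by (auto simp: difference_revenue_def A_def B_def)
  have "integral (cbox (c1, c2) (d1, d2)) (difference_revenue U k)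
      = integral (cbox (c1, c2) (d1, d2)) (\<lambda>z. A (fst z) (snd z))
        + integral (cbox (c1, c2) (d1, d2)) (\<lambda>z. B (fst z) (snd z))"
    unfolding split
    by (intro Henstock_Kurzweil_Integration.integral_add integrable_continuous A B)
  also have "\<dots> = integral {c1..d1} (\<lambda>x. integral {c2..d2} (A x))
        + integral {c1..d1} (\<lambda>x. integral {c2..d2} (B x))"
    using integral_prod_continuous[OF A] integral_prod_continuous[OF B] by simp
  \<comment> \<open>The item 2 bound contributes \<open>b1 * b2^2 / 2\<close>. Replacing it by means
    of \<open>deficit\<close> cancels all terms in \<open>V\<close> and \<open>\<Phi>\<close> and
    leaves \<open>b1 * b2 * c2\<close>.\<close>
  finally show ?thesis
    using A_total B_total deficit
    by (simp add: K_def d1_def d2_def power2_eq_square algebra_simps add_divide_distrib)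
qed

section \<open>The utility of a mechanism as a supremum of affine functions\<close>

definition indirect_utility ::
  "(real \<times> real) set \<Rightarrow> (real \<times> real \<Rightarrow> real \<times> real) \<Rightarrow> (real \<times> real \<Rightarrow> real) \<Rightarrow> real \<times> real \<Rightarrow> real" where
  "indirect_utility D q t z = (SUP w\<in>D. z \<bullet> q w - t w)"

context
  fixes D q t
  assumes mech: "mechanism D q t" and nonempty: "D \<noteq> {}"
begin

lemma mechanism_bounds:
  assumes "w \<in> D"
  shows "0 \<le> fst (q w)" "fst (q w) \<le> 1" "0 \<le> snd (q w)" "snd (q w) \<le> 1" "0 \<le> t w"
  using mech assms by (auto simp: mechanism_def mem_Times_iff)

text \<open>The supremum is meaningful at every point of the plane: allocations in the unit square
  and nonnegative payments bound every report's value by the 1-norm of \<open>z\<close>.\<close>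

lemma report_le_indirect_utility:
  assumes "w \<in> D"
  shows "z \<bullet> q w - t w \<le> indirect_utility D q t z"
  unfolding indirect_utility_def
proof (intro cSUP_upper bdd_aboveI2 assms)
  fix v assume v: "v \<in> D"
  have "x * p \<le> \<bar>x\<bar>" if "0 \<le> p" "p \<le> 1" for x p :: real
    using that by (smt (verit) mult_left_le mult_nonneg_nonneg mult_minus_left)
  from this[of "fst (q v)" "fst z"] this[of "snd (q v)" "snd z"]
  show "z \<bullet> q v - t v \<le> \<bar>fst z\<bar> + \<bar>snd z\<bar>"
    using mechanism_bounds[OF v] by (auto simp: inner_prod_def)
qed

lemma indirect_utility_le:
  assumes "\<And>w. w \<in> D \<Longrightarrow> z \<bullet> q w - t w \<le> C"
  shows "indirect_utility D q t z \<le> C"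
  unfolding indirect_utility_def using nonempty assms by (rule cSUP_least)

lemma indirect_utility_eq:
  assumes "incentive_compatible D q t" "z \<in> D"
  shows "indirect_utility D q t z = z \<bullet> q z - t z"
  using assms report_le_indirect_utility[of z z]
  by (intro antisym indirect_utility_le) (auto simp: incentive_compatible_def)

text \<open>Each report contributes an affine function with slopes in [0, 1], and this passes to the
  supremum. It holds on the whole plane, as difference quotients near the upper edges of
  \<open>D\<close> evaluate the utility outside \<open>D\<close>.\<close>

lemma unit_slope_indirect_utility:
  shows "unit_slope (\<lambda>x. indirect_utility D q t (x, y))"
    and "unit_slope (\<lambda>y. indirect_utility D q t (x, y))"
  unfolding unit_slope_def
proof (safe intro!: indirect_utility_le)
  fix x1 x2 :: real and w assume "x1 \<le> x2" and w: "w \<in> D"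
  have "(x2 - x1) * fst (q w) \<le> (x2 - x1) * 1" "0 \<le> (x2 - x1) * fst (q w)"
    using \<open>x1 \<le> x2\<close> mechanism_bounds[OF w] by (intro mult_left_mono mult_nonneg_nonneg; simp)+
  then show "(x1, y) \<bullet> q w - t w \<le> indirect_utility D q t (x2, y)"
    "(x2, y) \<bullet> q w - t w \<le> indirect_utility D q t (x1, y) + (x2 - x1)"
    using report_le_indirect_utility[OF w, of "(x1, y)"] report_le_indirect_utility[OF w, of "(x2, y)"]
    by (auto simp: inner_prod_def algebra_simps)
next
  fix y1 y2 :: real and w assume "y1 \<le> y2" and w: "w \<in> D"
  have "(y2 - y1) * snd (q w) \<le> (y2 - y1) * 1" "0 \<le> (y2 - y1) * snd (q w)"
    using \<open>y1 \<le> y2\<close> mechanism_bounds[OF w] by (intro mult_left_mono mult_nonneg_nonneg; simp)+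
  then show "(x, y1) \<bullet> q w - t w \<le> indirect_utility D q t (x, y2)"
    "(x, y2) \<bullet> q w - t w \<le> indirect_utility D q t (x, y1) + (y2 - y1)"
    using report_le_indirect_utility[OF w, of "(x, y1)"] report_le_indirect_utility[OF w, of "(x, y2)"]
    by (auto simp: inner_prod_def algebra_simps)
qed

lemma indirect_utility_convex_fst:
  assumes "0 \<le> l" "l \<le> 1"
  shows "indirect_utility D q t (l * x + (1 - l) * x', y)
      \<le> l * indirect_utility D q t (x, y) + (1 - l) * indirect_utility D q t (x', y)"
proof (rule indirect_utility_le)
  fix w assume w: "w \<in> D"
  have "(l * x + (1 - l) * x', y) \<bullet> q w - t w
      = l * ((x, y) \<bullet> q w - t w) + (1 - l) * ((x', y) \<bullet> q w - t w)"
    by (simp add: inner_prod_def algebra_simps)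
  also have "\<dots> \<le> l * indirect_utility D q t (x, y) + (1 - l) * indirect_utility D q t (x', y)"
    using assms by (intro add_mono mult_left_mono report_le_indirect_utility w) auto
  finally show "(l * x + (1 - l) * x', y) \<bullet> q w - t w
      \<le> l * indirect_utility D q t (x, y) + (1 - l) * indirect_utility D q t (x', y)" .
qed

text \<open>The allocation is a subgradient of the indirect utility, so difference quotients dominate it.\<close>

lemma payment_le_difference_revenue:
  assumes ic: "incentive_compatible D q t" and z: "z \<in> D" "0 \<le> fst z" "0 \<le> snd z" and "0 < k"
  shows "t z \<le> difference_revenue (indirect_utility D q t) k z"
proof -
  obtain x y where xy: "z = (x, y)" by (cases z)
  let ?U = "indirect_utility D q t"
  have U: "?U (x, y) = (x, y) \<bullet> q z - t z"
    using indirect_utility_eq[OF ic z(1)] by (simp add: xy)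
  have "fst (q z) \<le> (?U (x + k, y) - ?U (x, y)) / k" "snd (q z) \<le> (?U (x, y + k) - ?U (x, y)) / k"
    using report_le_indirect_utility[OF z(1), of "(x + k, y)"]
      report_le_indirect_utility[OF z(1), of "(x, y + k)"] \<open>0 < k\<close>
    by (auto simp: U inner_prod_def field_simps)
  then have "x * fst (q z) \<le> x * ((?U (x + k, y) - ?U (x, y)) / k)"
    "y * snd (q z) \<le> y * ((?U (x, y + k) - ?U (x, y)) / k)"
    using z by (intro mult_left_mono; simp add: xy)+
  moreover have "t z = x * fst (q z) + y * snd (q z) - ?U (x, y)"
    by (simp add: U inner_prod_def)
  ultimately show ?thesis
    unfolding xy difference_revenue_def by simp
qed

end

section \<open>Expected revenue under the uniform law on a box\<close>

lemma continuous_difference_revenue: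
  assumes U: "continuous_on UNIV U" and "0 < k"
  shows "continuous_on S (difference_revenue U k)"
  unfolding difference_revenue_def case_prod_unfold
  using \<open>0 < k\<close> by (auto intro!: continuous_intros continuous_on_compose2[OF U])

lemma emeasure_lebesgue_on_cbox:
  "emeasure (lebesgue_on (cbox a b)) (cbox a b) = ennreal (measure lborel (cbox a b))"
proof -
  have "emeasure lborel (cbox a b) = ennreal (measure lborel (cbox a b))"
    using emeasure_lborel_cbox_finite[of a b] by (intro emeasure_eq_ennreal_measure) auto
  then show ?thesis
    by (simp add: emeasure_restrict_space)
qed

text \<open>This connects the expectation, a Bochner integral, with the gauge integrals of the
  estimates above.\<close>

lemma expected_revenue_uniform_on_box:
  fixes a b :: "real \<times> real"
  assumes f: "continuous_on (cbox a b) f" and pos: "0 < measure lborel (cbox a b)"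
  shows "expected_revenue (uniform_on (cbox a b)) f = integral (cbox a b) f / measure lborel (cbox a b)"
    and "integrable (uniform_on (cbox a b)) f"
proof -
  let ?M = "lebesgue_on (cbox a b)"
  have int: "integrable ?M f"
    by (rule continuous_imp_integrable[OF f])
  have meas: "measure ?M (cbox a b) = measure lborel (cbox a b)"
    by (simp add: measure_restrict_space)
  have em: "emeasure ?M (cbox a b) \<noteq> 0" "emeasure ?M (cbox a b) \<noteq> \<infinity>"
    using pos by (auto simp: emeasure_lebesgue_on_cbox)
  have restrict: "integral\<^sup>L ?M (\<lambda>x. indicator (cbox a b) x * f x) = integral\<^sup>L ?M f"
    by (intro Bochner_Integration.integral_cong) auto
  have restrict': "integrable ?M (\<lambda>x. indicator (cbox a b) x * f x) \<longleftrightarrow> integrable ?M f"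
    by (intro Bochner_Integration.integrable_cong) auto
  note um = integral_uniform_measure[OF _ borel_measurable_integrable[OF int] em]
  show "expected_revenue (uniform_on (cbox a b)) f = integral (cbox a b) f / measure lborel (cbox a b)"
    unfolding expected_revenue_def uniform_on_def
    by (subst um(1)) (auto simp: restrict meas lebesgue_integral_eq_integral[OF int] sets_restrict_space)
  show "integrable (uniform_on (cbox a b)) f"
    unfolding uniform_on_def by (subst um(2)) (auto simp: restrict' int sets_restrict_space)
qed

section \<open>The two-option menu, its revenue and its optimality\<close>

theorem theorem5:
  fixes c1 c2 b1 b2 :: real
  assumes "c1 \<ge> 0" and "c2 \<ge> 0" and "b1 > 0" and "b2 > 0"
    and "c1 < b1"
    and "c2 \<ge> 2 * b2 * (b1 / (b1 - c1))\<^sup>2"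
  shows "optimal_mechanism (uniform_on ({c1..c1 + b1} \<times> {c2..c2 + b2}))
           (\<lambda>(z1, z2). if z1 < (c1 + b1) / 2 then (0, 1) else (1, 1))
           (\<lambda>(z1, z2). if z1 < (c1 + b1) / 2 then c2 else c2 + (c1 + b1) / 2)"
proof -
  define p where "p = (c1 + b1) / 2"
  define D where "D = cbox (c1, c2) (c1 + b1, c2 + b2)"
  define q0 where "q0 = (\<lambda>(z1::real, z2::real). if z1 < p then (0::real, 1::real) else (1, 1))"
  define t0 where "t0 = (\<lambda>(z1::real, z2::real). if z1 < p then c2 else c2 + p)"
  have D: "D = {c1..c1 + b1} \<times> {c2..c2 + b2}"
    by (auto simp: D_def cbox_Pair_eq)
  have p: "0 \<le> p" "c1 \<le> p" "p \<le> c1 + b1"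
    using assms by (auto simp: p_def)
  have vol: "measure lborel D = b1 * b2"
    using assms by (simp add: D_def content_Pair)
  have vol_pos: "0 < measure lborel D"
    using assms by (simp add: vol)
  have emeasure_D: "emeasure (lebesgue_on D) D = ennreal (b1 * b2)"
    using vol by (simp add: D_def emeasure_lebesgue_on_cbox)
  interpret uniform: finite_measure "uniform_on D"
    unfolding uniform_on_def
    using assms by (intro finite_measureI) (simp add: emeasure_D emeasure_uniform_measure_1)
  have total: "measure (uniform_on D) D = 1"
    unfolding uniform_on_def
    using assms by (subst measure_uniform_measure) (auto simp: emeasure_D measure_def sets_restrict_space)

  \<comment> \<open>On \<open>D\<close>, the payment \<open>t0\<close> is \<open>c2\<close> plus
    \<open>p\<close> on \<open>A\<close>. Since \<open>c1 + b1 = 2 * p\<close>, the box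
    \<open>A\<close> has width \<open>p\<close> and probability \<open>p / b1\<close>.\<close>
  define A where "A = cbox (p, c2) (c1 + b1, c2 + b2)"
  have "A \<subseteq> D"
    using p by (auto simp: A_def D cbox_Pair_eq)
  have t0_rev: "expected_revenue (uniform_on D) t0 = c2 + p\<^sup>2 / b1"
  proof -
    have "A \<in> sets (lebesgue_on D)" "D \<in> sets (lebesgue_on D)"
      using \<open>A \<subseteq> D\<close> by (auto simp: sets_restrict_space_iff A_def D_def)
    then have meas: "A \<in> sets (uniform_on D)"
      and "measure (uniform_on D) A = measure (lebesgue_on D) (D \<inter> A) / measure (lebesgue_on D) D"
      using vol_pos vol unfolding uniform_on_def
      by (auto simp: emeasure_D ennreal_eq_0_iff intro!: measure_uniform_measure)
    then have prob_A: "measure (uniform_on D) A = measure lborel A / (b1 * b2)"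
      using \<open>A \<subseteq> D\<close> unfolding vol[symmetric] by (simp add: measure_restrict_space Int_absorb1 A_def D_def)
    have "expected_revenue (uniform_on D) t0 = (\<integral>z. c2 + p * indicator A z \<partial>uniform_on D)"
      unfolding expected_revenue_def
      by (intro Bochner_Integration.integral_cong) (auto simp: t0_def A_def D cbox_Pair_eq)
    also have "\<dots> = c2 + p * measure (uniform_on D) A"
    proof -
      have "integrable (uniform_on D) (indicator A :: _ \<Rightarrow> real)"
        using meas by (intro integrable_real_indicator) (auto simp: less_top[symmetric])
      then show ?thesis
        using total \<open>A \<subseteq> D\<close> by (subst Bochner_Integration.integral_add) (auto simp: Int_absorb2)
    qed
    also have "measure (uniform_on D) A = p / b1"
      unfolding prob_A using assms p by (simp add: A_def content_Pair p_def field_simps)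
    finally show ?thesis
      using assms by (simp add: power2_eq_square)
  qed

  show ?thesis
    unfolding D[symmetric] p_def[symmetric] q0_def[symmetric] t0_def[symmetric]
      optimal_mechanism_def space_uniform_on
  proof (intro conjI allI impI)
    show "mechanism D q0 t0"
      using p assms by (auto simp: mechanism_def q0_def t0_def)
    \<comment> \<open>The truthful utility is \<open>z2 - c2\<close> plus the positive part of
      \<open>z1 - p\<close>.\<close>
    show "incentive_compatible D q0 t0"
      by (auto simp: incentive_compatible_def q0_def t0_def inner_prod_def)
    show "individually_rational D q0 t0"
      using p assms by (auto simp: individually_rational_def q0_def t0_def inner_prod_def D)
    fix q t
    assume mech: "mechanism D q t" and ic: "incentive_compatible D q t"
      and ir: "individually_rational D q t"
    show "expected_revenue (uniform_on D) t \<le> expected_revenue (uniform_on D) t0"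
    proof (cases "integrable (uniform_on D) t")
      \<comment> \<open>A payment that is not integrable has Bochner integral 0, and the claimed
        revenue is nonnegative.\<close>
      case False
      then show ?thesis
        using assms by (simp add: t0_rev) (simp add: expected_revenue_def not_integrable_integral_eq)
    next
      case True
      have "D \<noteq> {}" and corner: "(c1, c2) \<in> D"
        using assms by (auto simp: D)
      note U = mech \<open>D \<noteq> {}\<close>
      define U where "U = indirect_utility D q t"
      \<comment> \<open>\<open>K\<close> collects the errors of order \<open>k\<close>, divided by
        the area of \<open>D\<close>. It does not depend on \<open>k\<close>, so the error vanishes
        as \<open>k\<close> tends to 0 from the right.\<close>
      define K where "K = (b2 * (U (c1 + b1, c2 + b2) + (c1 + b1) + 1) + b1 * c2) / (b1 * b2)"
      note slope = unit_slope_indirect_utility[OF U, folded U_def]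
      have U0: "0 \<le> U (c1, c2)"
        using ir corner by (auto simp: U_def indirect_utility_eq[OF U ic corner] individually_rational_def)
      have bound: "expected_revenue (uniform_on D) t \<le> c2 + p\<^sup>2 / b1 + k * K" if k: "0 < k" "k \<le> 1" for k
      proof -
        have cont: "continuous_on D (difference_revenue U k)"
          using slope k by (intro continuous_difference_revenue nonexpansive_sections_continuous)
        have "expected_revenue (uniform_on D) t \<le> expected_revenue (uniform_on D) (difference_revenue U k)"
          unfolding expected_revenue_def
        proof (rule integral_mono[OF True])
          show "integrable (uniform_on D) (difference_revenue U k)"
            using expected_revenue_uniform_on_box(2)[OF cont[unfolded D_def]] vol_pos by (simp add: D_def)
          fix z assume "z \<in> space (uniform_on D)"
          then show "t z \<le> difference_revenue U k z"
            unfolding U_def using k assms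
            by (intro payment_le_difference_revenue[OF U ic]) (auto simp: D)
        qed
        also have "\<dots> = integral D (difference_revenue U k) / (b1 * b2)"
          using expected_revenue_uniform_on_box(1)[OF cont[unfolded D_def]] vol_pos by (simp add: D_def flip: vol)
        also have "\<dots> \<le> (b1 * b2 * c2 + b2 * p\<^sup>2 + k * (K * (b1 * b2))) / (b1 * b2)"
          using integral_difference_revenue_le[OF assms(1,2,4-6) slope _ U0 k]
            indirect_utility_convex_fst[OF U, folded U_def] assms
          by (intro divide_right_mono) (auto simp: D_def p_def K_def)
        also have "\<dots> = c2 + p\<^sup>2 / b1 + k * K"
          using assms by (simp add: field_simps)
        finally show ?thesis .
      qed
      have "((\<lambda>k. c2 + p\<^sup>2 / b1 + k * K) \<longlongrightarrow> c2 + p\<^sup>2 / b1 + 0 * K) (at_right 0)"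
        by (intro tendsto_intros)
      moreover have "\<forall>\<^sub>F k in at_right 0. expected_revenue (uniform_on D) t \<le> c2 + p\<^sup>2 / b1 + k * K"
        using eventually_at_right_real[of 0 "1::real"]
        by (auto elim!: eventually_mono intro!: bound)
      ultimately show ?thesis
        unfolding t0_rev by (intro tendsto_lowerbound[where F = "at_right (0::real)"]) auto
    qed
  qed
qed

end
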